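(* Let $\Gamma$ be a finite group with right regular representation $\{R_g\}_{g\in\Gamma}$ and associated group algebra $\mathbb Z_2[\{R_g\}]$, and suppose $G$ is the Gramian of a binary Parseval $\Gamma$-frame $\mathcal F=\{f_g\}_{g\in\Gamma}$. Then $G$ is in the group algebra $\mathbb Z_2[\{R_g\}]$. More explicitly, $$G=\sum_{g\in\Gamma}\eta(g)R_g,$$ where $\eta:\Gamma\to\mathbb Z_2$ is defined by $\eta(g):=\langle f_g,f_e\rangle$.
   Context: All vectors and matrices are over the field $\mathbb Z_2$ with two elements. The dot product on $\mathbb Z_2^n$ is $\langle a,b\rangle=\sum_{i=1}^n a_ib_i\in\mathbb Z_2$. A finite family $\{f_j\}_{j\in J}$ in $\mathbb Z_2^n$ is a binary Parseval frame if $x=\sum_{j\in J}\langle x,f_j\rangle f_j$ for all $x\in\mathbb Z_2^n$. For a finite group $\Gamma$ with identity $e$, a family $\{f_g\}_{g\in\Gamma}$ in $\mathbb Z_2^n$ is a binary Parseval $\Gamma$-frame if it is a binary Parseval frame and there is a representation (group homomorphism) $\rho:\Gamma\to \mathrm{GL}(\mathbb Z_2^n)$ with $f_g=\rho(g)f_e$ for all $g\in\Gamma$. The analysis operator is $\Theta:\mathbb Z_2^n\to\mathbb Z_2^\Gamma$, $(\Theta x)(g)=\langle x,f_g\rangle$, with transpose $\Theta^*h=\sum_{g}h(g)f_g$; the Gramian is the linear map $G=\Theta\Theta^*:\mathbb Z_2^\Gamma\to\mathbb Z_2^\Gamma$, whose matrix entries in the standard basis are $G_{a,b}=\langle f_b,f_a\rangle$.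 The right regular representation acts on $\mathbb Z_2^\Gamma$ (functions $\varphi:\Gamma\to\mathbb Z_2$) by $(R_g\varphi)(h)=\varphi(hg)$. $\mathbb Z_2[\{R_g\}]$ is the set of all $\mathbb Z_2$-linear combinations $\sum_{g\in\Gamma}c(g)R_g$. *)

theory Defs
  imports
    "HOL-Algebra.Group"
    "HOL-Analysis.Cartesian_Space"
    "HOL-Library.FuncSet"
    "HOL-Library.Z2"
begin

definition dot2 :: "bit ^ 'n \<Rightarrow> bit ^ 'n \<Rightarrow> bit" where
  "dot2 a b = (\<Sum>i\<in>UNIV. a $ i * b $ i)"

definition binary_parseval_frame :: "'j set \<Rightarrow> ('j \<Rightarrow> bit ^ 'n) \<Rightarrow> bool" where
  "binary_parseval_frame J f \<longleftrightarrow>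
     finite J \<and> (\<forall>x. x = (\<Sum>j\<in>J. dot2 x (f j) *s f j))"

definition GL2 :: "(bit ^ 'n \<Rightarrow> bit ^ 'n) monoid" where
  "GL2 = \<lparr>carrier = {T. Vector_Spaces.linear (*s) (*s) T \<and> bij T},
          monoid.mult = (\<circ>), one = id\<rparr>"

definition binary_parseval_group_frame ::
    "('g, 'm) monoid_scheme \<Rightarrow> ('g \<Rightarrow> bit ^ 'n) \<Rightarrow> bool" where
  "binary_parseval_group_frame \<Gamma> f \<longleftrightarrow>
     binary_parseval_frame (carrier \<Gamma>) f \<and>
     (\<exists>\<rho>\<in>hom \<Gamma> GL2. \<forall>g\<in>carrier \<Gamma>. f g = \<rho> g (f \<one>\<^bsub>\<Gamma>\<^esub>))"

text \<open>
  The space of functions from the group to the two-element field is represented by functions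
  that are extensional on the carrier, and operators on it are in turn extensional on that
  space. Hence HOL equality of operators is equality of maps on the function space.
\<close>

definition fun_space :: "('g, 'm) monoid_scheme \<Rightarrow> ('g \<Rightarrow> bit) set" where
  "fun_space \<Gamma> = (carrier \<Gamma> \<rightarrow>\<^sub>E UNIV)"

definition analysis_op ::
    "('g, 'm) monoid_scheme \<Rightarrow> ('g \<Rightarrow> bit ^ 'n) \<Rightarrow> bit ^ 'n \<Rightarrow> ('g \<Rightarrow> bit)" where
  "analysis_op \<Gamma> f x = (\<lambda>g\<in>carrier \<Gamma>. dot2 x (f g))"

definition synthesis_op ::
    "('g, 'm) monoid_scheme \<Rightarrow> ('g \<Rightarrow> bit ^ 'n) \<Rightarrow> ('g \<Rightarrow> bit) \<Rightarrow> bit ^ 'n" where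
  "synthesis_op \<Gamma> f h = (\<Sum>g\<in>carrier \<Gamma>. h g *s f g)"

definition gramian ::
    "('g, 'm) monoid_scheme \<Rightarrow> ('g \<Rightarrow> bit ^ 'n) \<Rightarrow> ('g \<Rightarrow> bit) \<Rightarrow> ('g \<Rightarrow> bit)" where
  "gramian \<Gamma> f = (\<lambda>h\<in>fun_space \<Gamma>. analysis_op \<Gamma> f (synthesis_op \<Gamma> f h))"

definition right_regular ::
    "('g, 'm) monoid_scheme \<Rightarrow> 'g \<Rightarrow> ('g \<Rightarrow> bit) \<Rightarrow> ('g \<Rightarrow> bit)" where
  "right_regular \<Gamma> g = (\<lambda>\<phi>\<in>fun_space \<Gamma>. \<lambda>h\<in>carrier \<Gamma>. \<phi> (h \<otimes>\<^bsub>\<Gamma>\<^esub> g))"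

definition regular_combination ::
    "('g, 'm) monoid_scheme \<Rightarrow> ('g \<Rightarrow> bit) \<Rightarrow> ('g \<Rightarrow> bit) \<Rightarrow> ('g \<Rightarrow> bit)" where
  "regular_combination \<Gamma> c =
     (\<lambda>\<phi>\<in>fun_space \<Gamma>. \<lambda>h\<in>carrier \<Gamma>. \<Sum>g\<in>carrier \<Gamma>. c g * right_regular \<Gamma> g \<phi> h)"

definition group_algebra ::
    "('g, 'm) monoid_scheme \<Rightarrow> (('g \<Rightarrow> bit) \<Rightarrow> ('g \<Rightarrow> bit)) set" where
  "group_algebra \<Gamma> = regular_combination \<Gamma> ` fun_space \<Gamma>"

end

theory Submission
  imports Defs
begin

text \<open>
  Each \<open>T = \<rho> a\<close> permutes the frame vectors, so conjugating the Parseval identity by \<open>T\<close> gives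
  \<open>T T\<^sup>* = 1\<close>, and hence \<open>T\<^sup>* T = 1\<close> because \<open>T\<close> is invertible. The representation thus preserves
  the dot product, \<open>\<langle>f b, f a\<rangle>\<close> depends only on \<open>inv a \<otimes> b\<close>, and the substitution
  \<open>b = a \<otimes> g\<close> turns the Gramian into a combination of right translations.
\<close>

lemma dot2_sum_left: "dot2 (\<Sum>j\<in>J. c j *s f j) y = (\<Sum>j\<in>J. c j * dot2 (f j) y)"
  unfolding dot2_def sum_component vector_smult_component sum_distrib_right sum_distrib_left mult.assoc
  by (rule sum.swap)

lemma dot2_transpose: "dot2 (transpose A *v x) y = dot2 x (A *v y)"
  unfolding dot2_def matrix_vector_mult_def transpose_def vec_lambda_beta
    sum_distrib_right sum_distrib_left
  by (subst sum.swap) (simp only: ac_simps)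

text \<open>The permutation \<open>\<pi>\<close> acts on indices rather than on vectors, since a
  frame may repeat vectors and the Parseval sum counts them with multiplicity.\<close>

lemma parseval_permuting_map_isometry:
  assumes frame: "binary_parseval_frame J f"
    and lin: "Vector_Spaces.linear (*s) (*s) T"
    and "inj T"
    and perm: "bij_betw \<pi> J J"
    and T_f: "\<And>j. j \<in> J \<Longrightarrow> T (f j) = f (\<pi> j)"
  shows "dot2 (T x) (T y) = dot2 x y"
proof -
  interpret T: Vector_Spaces.linear "(*s)" "(*s)" T
    by (rule lin)
  let ?A = "matrix T"
  have A: "?A *v v = T v" for v
    by (rule matrix_works[OF lin])
  have parseval: "v = (\<Sum>j\<in>J. dot2 v (f j) *s f j)" for v
    using frame by (auto simp: binary_parseval_frame_def)
  \<comment> \<open>Expand the transposed vector in the frame: the transpose moves across the dot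
    product as \<open>T\<close>, so both occurrences of \<open>f j\<close> become
    \<open>f (\<pi> j)\<close>.\<close>
  have right_inverse: "T (transpose ?A *v v) = v" for v
  proof -
    have "T (transpose ?A *v v) = T (\<Sum>j\<in>J. dot2 (transpose ?A *v v) (f j) *s f j)"
      using parseval[of "transpose ?A *v v"] by simp
    also have "\<dots> = (\<Sum>j\<in>J. dot2 v (T (f j)) *s T (f j))"
      by (simp only: T.sum T.scale dot2_transpose A)
    also have "\<dots> = (\<Sum>j\<in>J. dot2 v (f (\<pi> j)) *s f (\<pi> j))"
      by (simp add: T_f)
    also have "\<dots> = (\<Sum>j\<in>J. dot2 v (f j) *s f j)"
      by (rule sum.reindex_bij_betw[OF perm])
    also have "\<dots> = v"
      by (rule parseval[symmetric])
    finally show ?thesis .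
  qed
  \<comment> \<open>At \<open>v = T x\<close> both sides are images under \<open>T\<close>, which
    injectivity cancels.\<close>
  then have "transpose ?A *v T x = x"
    using \<open>inj T\<close> by (blast dest: injD)
  then show ?thesis
    using dot2_transpose[of ?A "T x" y] by (simp add: A)
qed

lemma (in group) bij_betw_left_mult:
  "a \<in> carrier G \<Longrightarrow> bij_betw (\<lambda>g. a \<otimes> g) (carrier G) (carrier G)"
  by (rule bij_betw_byWitness[where f' = "\<lambda>g. inv a \<otimes> g"]) (auto simp: inv_solve_left' m_assoc[symmetric])

text \<open>Both vectors on the left are images under the isometry \<open>\<rho> a\<close>, of
  \<open>f g\<close> and of \<open>f \<one>\<close>. Writing the first index as
  \<open>a \<otimes> g\<close> avoids inverses.\<close>

lemma (in group) dot2_group_frame_translate: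
  assumes frame: "binary_parseval_group_frame G f"
    and a: "a \<in> carrier G" and g: "g \<in> carrier G"
  shows "dot2 (f (a \<otimes> g)) (f a) = dot2 (f g) (f \<one>)"
proof -
  obtain \<rho> where parseval: "binary_parseval_frame (carrier G) f"
    and hom: "\<rho> \<in> hom G GL2"
    and f: "\<And>g. g \<in> carrier G \<Longrightarrow> f g = \<rho> g (f \<one>)"
    using frame by (auto simp: binary_parseval_group_frame_def)
  have translate: "\<rho> a (f h) = f (a \<otimes> h)" if h: "h \<in> carrier G" for h
  proof -
    have "f (a \<otimes> h) = \<rho> (a \<otimes> h) (f \<one>)"
      using a h by (intro f) simp
    also have "\<dots> = \<rho> a (\<rho> h (f \<one>))"
      using hom_mult[OF hom a h] by (simp add: GL2_def)
    finally show ?thesis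
      using f[OF h] by simp
  qed
  have "\<rho> a \<in> carrier GL2"
    using hom a by (auto simp: hom_def)
  then have "Vector_Spaces.linear (*s) (*s) (\<rho> a)" "inj (\<rho> a)"
    by (auto simp: GL2_def bij_is_inj)
  from parseval_permuting_map_isometry[OF parseval this bij_betw_left_mult[OF a] translate]
  have "dot2 (\<rho> a (f g)) (\<rho> a (f \<one>)) = dot2 (f g) (f \<one>)" .
  then show ?thesis
    using a g by (simp add: translate)
qed

theorem theorem3p1:
  fixes \<Gamma> :: "('g, 'm) monoid_scheme"
    and f :: "'g \<Rightarrow> bit ^ 'n"
  assumes "group \<Gamma>"
    and "finite (carrier \<Gamma>)"
    and "binary_parseval_group_frame \<Gamma> f"
  shows "gramian \<Gamma> f \<in> group_algebra \<Gamma> \<and>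
    gramian \<Gamma> f = regular_combination \<Gamma> (\<lambda>g\<in>carrier \<Gamma>. dot2 (f g) (f \<one>\<^bsub>\<Gamma>\<^esub>))"
proof -
  interpret group \<Gamma>
    by (rule assms(1))
  let ?\<eta> = "\<lambda>g\<in>carrier \<Gamma>. dot2 (f g) (f \<one>\<^bsub>\<Gamma>\<^esub>)"
  have entry: "dot2 (synthesis_op \<Gamma> f \<phi>) (f a) =
      (\<Sum>g\<in>carrier \<Gamma>. ?\<eta> g * right_regular \<Gamma> g \<phi> a)"
    if \<phi>: "\<phi> \<in> fun_space \<Gamma>" and a: "a \<in> carrier \<Gamma>" for \<phi> a
  proof -
    have "dot2 (synthesis_op \<Gamma> f \<phi>) (f a) = (\<Sum>b\<in>carrier \<Gamma>. \<phi> b * dot2 (f b) (f a))"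
      by (simp add: synthesis_op_def dot2_sum_left)
    \<comment> \<open>Left multiplication by the row index \<open>a\<close> reindexes the sum; the
      factor \<open>\<phi> (a \<otimes> g)\<close> is then the right translate of
      \<open>\<phi>\<close> by \<open>g\<close>, evaluated at \<open>a\<close>.\<close>
    also have "\<dots> = (\<Sum>g\<in>carrier \<Gamma>.
        \<phi> (a \<otimes>\<^bsub>\<Gamma>\<^esub> g) * dot2 (f (a \<otimes>\<^bsub>\<Gamma>\<^esub> g)) (f a))"
      by (rule sum.reindex_bij_betw[OF bij_betw_left_mult[OF a], symmetric])
    also have "\<dots> = (\<Sum>g\<in>carrier \<Gamma>. ?\<eta> g * right_regular \<Gamma> g \<phi> a)"
      using \<phi> a
      by (intro sum.cong) (simp_all add: dot2_group_frame_translate[OF assms(3)] right_regular_def mult.commute)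
    finally show ?thesis .
  qed
  \<comment> \<open>Both operators are restricted to the same domains, so agreement of their values
    at each \<open>\<phi>\<close> and \<open>a\<close> suffices.\<close>
  have "gramian \<Gamma> f = regular_combination \<Gamma> ?\<eta>"
    unfolding gramian_def regular_combination_def analysis_op_def
    by (intro restrict_ext entry)
  moreover have "?\<eta> \<in> fun_space \<Gamma>"
    by (simp add: fun_space_def)
  ultimately show ?thesis
    by (auto simp: group_algebra_def)
qed

end
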